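(* Let $K\subseteq\mathbb{R}^k$ be a nontrivial pointed closed convex cone, and let $L\in\mathbb{R}^{k\times n}$, $A\in\mathbb{R}^{m\times n}$, $b\in\mathbb{R}^m$. Let $$\mathcal{B}^H=\{U\in\mathbb{R}^{k\times m} : \nexists\, x\in\mathbb{R}^n_+ \text{ such that } (L-UA)x\leq_K 0\},$$ $$h^H(U)=Ub+\operatorname{Min}\big((L-UA)(\mathbb{R}^n_+),K\big)\subseteq\mathbb{R}^k\quad (U\in\mathcal{B}^H),$$ $$\mathcal{B}=\{(\lambda,U,v)\in K^{*0}\times\mathbb{R}^{k\times m}\times\mathbb{R}^k : \lambda^Tv=0 \text{ and } (L-UA)^T\lambda\in\mathbb{R}^n_+\},\qquad h(\lambda,U,v)=Ub+v.$$ Then $h^H(\mathcal{B}^H)\subseteq h(\mathcal{B})$, where $h^H(\mathcal{B}^H)=\bigcup_{U\in\mathcal{B}^H}h^H(U)$.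
   Context: $\mathbb{R}^n_+$ denotes the nonnegative orthant. A set $K\subseteq\mathbb{R}^k$ is a cone if $\lambda K\subseteq K$ for all $\lambda\geq 0$; it is nontrivial if $K\neq\{0\}$ and $K\neq\mathbb{R}^k$, and pointed if $K\cap(-K)=\{0\}$. Write $v\leqq_K w$ if $w-v\in K$, and $v\leq_K w$ if $v\leqq_K w$ and $v\neq w$. Set $K^{*0}=\{\lambda\in\mathbb{R}^k:\lambda^Tv>0\ \forall v\in K\setminus\{0\}\}$. For $M\subseteq\mathbb{R}^k$ nonempty, $\operatorname{Min}(M,K)$ is the set of all $\bar v\in M$ for which there is no $v\in M$ with $v\leq_K\bar v$. The map $h^H$ is set-valued: $Ub+S=\{Ub+s:s\in S\}$. *)

theory Defs
  imports "HOL-Analysis.Analysis"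
begin

text \<open>
  Vectors are columns \<open>real ^ 'n\<close>, and a \<open>k \<times> n\<close> matrix has type \<open>real ^ 'n ^ 'k\<close>.
  The library predicate \<^const>\<open>cone\<close> (closure under scaling by all nonnegative reals) admits the
  empty set, which \<open>pointed\<close> below excludes.
\<close>

definition nonneg_orthant :: "(real ^ 'n) set" where
  "nonneg_orthant = {x. \<forall>i. 0 \<le> x $ i}"

definition nontrivial :: "(real ^ 'k) set \<Rightarrow> bool" where
  "nontrivial K \<longleftrightarrow> K \<noteq> {0} \<and> K \<noteq> UNIV"

definition pointed :: "(real ^ 'k) set \<Rightarrow> bool" where
  "pointed K \<longleftrightarrow> K \<inter> uminus ` K = {0}"

definition cone_le :: "(real ^ 'k) set \<Rightarrow> real ^ 'k \<Rightarrow> real ^ 'k \<Rightarrow> bool" where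
  "cone_le K v w \<longleftrightarrow> w - v \<in> K"

text \<open>\<open>v \<le>\<^sub>K w\<close>: the order induced by \<open>K\<close> with equality excluded (no interior of \<open>K\<close> is involved).\<close>

definition cone_less :: "(real ^ 'k) set \<Rightarrow> real ^ 'k \<Rightarrow> real ^ 'k \<Rightarrow> bool" where
  "cone_less K v w \<longleftrightarrow> cone_le K v w \<and> v \<noteq> w"

definition strict_dual_cone :: "(real ^ 'k) set \<Rightarrow> (real ^ 'k) set" where
  "strict_dual_cone K = {l. \<forall>v \<in> K - {0}. l \<bullet> v > 0}"

definition cone_Min :: "(real ^ 'k) set \<Rightarrow> (real ^ 'k) set \<Rightarrow> (real ^ 'k) set" where
  "cone_Min M K = {v \<in> M. \<not> (\<exists>w \<in> M. cone_less K w v)}"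

definition dual_feasible_H ::
    "(real ^ 'k) set \<Rightarrow> real ^ 'n ^ 'k \<Rightarrow> real ^ 'n ^ 'm \<Rightarrow> (real ^ 'm ^ 'k) set" where
  "dual_feasible_H K L A =
     {U. \<not> (\<exists>x \<in> nonneg_orthant. cone_less K ((L - U ** A) *v x) 0)}"

definition dual_objective_H ::
    "(real ^ 'k) set \<Rightarrow> real ^ 'n ^ 'k \<Rightarrow> real ^ 'n ^ 'm \<Rightarrow> real ^ 'm
      \<Rightarrow> real ^ 'm ^ 'k \<Rightarrow> (real ^ 'k) set" where
  "dual_objective_H K L A b U =
     (\<lambda>s. U *v b + s) ` cone_Min ((\<lambda>x. (L - U ** A) *v x) ` nonneg_orthant) K"

definition dual_feasible ::
    "(real ^ 'k) set \<Rightarrow> real ^ 'n ^ 'k \<Rightarrow> real ^ 'n ^ 'm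
      \<Rightarrow> ((real ^ 'k) \<times> (real ^ 'm ^ 'k) \<times> (real ^ 'k)) set" where
  "dual_feasible K L A =
     {(l, U, v). l \<in> strict_dual_cone K \<and> l \<bullet> v = 0 \<and>
                 transpose (L - U ** A) *v l \<in> nonneg_orthant}"

definition dual_objective ::
    "real ^ 'm \<Rightarrow> (real ^ 'k) \<times> (real ^ 'm ^ 'k) \<times> (real ^ 'k) \<Rightarrow> real ^ 'k" where
  "dual_objective b = (\<lambda>(l, U, v). U *v b + v)"

end

theory Submission
  imports Defs
begin

text \<open>
  Let \<open>C = L - U A\<close> and let \<open>s\<close> be minimal in \<open>P = C(\<real>\<^sup>n\<^sub>+)\<close>. Since \<open>P\<close> is a cone, minimality
  of \<open>s\<close> says that the cone \<open>{t s - p | t \<ge> 0, p \<in> P}\<close> meets \<open>K\<close> only in \<open>0\<close>. This cone is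
  finitely generated, hence closed, so some \<open>\<lambda>\<close> is positive on \<open>K - {0}\<close> and nonpositive on it.
  Then \<open>\<lambda> \<ge> 0\<close> on \<open>P\<close> and \<open>\<lambda>\<^sup>T s = 0\<close>, so \<open>(\<lambda>, U, s)\<close> is feasible with value \<open>U b + s\<close>.
\<close>

text \<open>The unit vectors of \<open>K\<close> have a compact convex hull, which pointedness keeps
  away from 0. This base can be strictly separated from the closed cone \<open>Q\<close>, and
  scaling turns the separating level into the two sign conditions.\<close>

lemma strict_separation_pointed_cone:
  fixes K Q :: "'a::euclidean_space set"
  assumes K: "convex_cone K" "closed K" and pointed: "\<And>x. x \<in> K \<Longrightarrow> - x \<in> K \<Longrightarrow> x = 0"
    and Q: "convex_cone Q" "closed Q"
    and disj: "K \<inter> Q \<subseteq> {0}"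
  obtains l where "\<And>x. x \<in> K - {0} \<Longrightarrow> 0 < l \<bullet> x" "\<And>x. x \<in> Q \<Longrightarrow> l \<bullet> x \<le> 0"
proof (cases "K \<subseteq> {0}")
  \<comment> \<open>Here the base used in the other case would be empty; the zero functional already
    satisfies both conditions.\<close>
  case True
  then show ?thesis using that[of 0] by auto
next
  case False
  define B where "B = convex hull (K \<inter> sphere 0 1)"
  have normalise: "x /\<^sub>R norm x \<in> B" if "x \<in> K - {0}" for x
    unfolding B_def using that K(1)
    by (intro hull_inc) (auto simp: convex_cone_iff)
  \<comment> \<open>A vanishing convex combination would put a vector of \<open>K\<close> and its
    negative both in \<open>K\<close>. Convexity of \<open>K - {0}\<close> is what keeps the hull
    \<open>B\<close> off the origin.\<close>
  have "convex (K - {0})"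
  proof (rule convexI)
    fix x y :: 'a and u v :: real
    assume xy: "x \<in> K - {0}" "y \<in> K - {0}" and uv: "0 \<le> u" "0 \<le> v" "u + v = 1"
    have mem: "u *\<^sub>R x \<in> K" "v *\<^sub>R y \<in> K"
      using K(1) xy uv by (auto simp: convex_cone_iff)
    have "u *\<^sub>R x + v *\<^sub>R y \<noteq> 0"
    proof
      assume "u *\<^sub>R x + v *\<^sub>R y = 0"
      then have eq: "v *\<^sub>R y = - (u *\<^sub>R x)"
        by (simp add: add_eq_0_iff)
      then have "u *\<^sub>R x = 0"
        using pointed mem by metis
      with eq xy uv show False by auto
    qed
    with mem K(1) show "u *\<^sub>R x + v *\<^sub>R y \<in> K - {0}"
      by (auto simp: convex_cone_iff)
  qed
  then have "B \<subseteq> K - {0}"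
    unfolding B_def by (intro hull_minimal) auto
  then have "Q \<inter> B = {}" using disj by auto
  moreover have "compact B"
    unfolding B_def using K(2) by (intro compact_convex_hull closed_Int_compact) auto
  moreover have "B \<noteq> {}" using False normalise by auto
  moreover have "convex B" "convex Q"
    using Q(1) by (auto simp: B_def convex_cone_def)
  ultimately obtain l b where lb: "\<And>x. x \<in> Q \<Longrightarrow> l \<bullet> x < b" "\<And>x. x \<in> B \<Longrightarrow> b < l \<bullet> x"
    using separating_hyperplane_closed_compact[of Q B] Q(2) by blast
  have "0 < b" using lb(1)[of 0] Q(1) by (simp add: convex_cone_iff)
  show ?thesis
  proof
    fix x assume x: "x \<in> K - {0}"
    then have "0 < l \<bullet> (x /\<^sub>R norm x)"
      using lb(2) normalise \<open>0 < b\<close> by force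
    then show "0 < l \<bullet> x" using x by (simp add: zero_less_mult_iff zero_less_divide_iff)
  next
    fix x assume x: "x \<in> Q"
    show "l \<bullet> x \<le> 0"
    proof (rule ccontr)
      assume "\<not> l \<bullet> x \<le> 0"
      then have pos: "0 < l \<bullet> x" by simp
      \<comment> \<open>The scaling puts the point exactly on the hyperplane at level
        \<open>b\<close>, where the bound on \<open>Q\<close> is strict.\<close>
      then have "(b / (l \<bullet> x)) *\<^sub>R x \<in> Q"
        using Q(1) x \<open>0 < b\<close> by (auto simp: convex_cone_iff)
      from lb(1)[OF this] pos show False by simp
    qed
  qed
qed

lemma nonneg_orthant_closed_under:
  "0 \<in> nonneg_orthant"
  "x \<in> nonneg_orthant \<Longrightarrow> y \<in> nonneg_orthant \<Longrightarrow> x + y \<in> nonneg_orthant"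
  "x \<in> nonneg_orthant \<Longrightarrow> 0 \<le> c \<Longrightarrow> c *\<^sub>R x \<in> nonneg_orthant"
  by (auto simp: nonneg_orthant_def)

lemma transpose_mult_nth:
  fixes C :: "real ^ 'n ^ 'k"
  shows "(transpose C *v l) $ i = l \<bullet> (C *v axis i 1)"
  by (metis cart_eq_inner_axis dot_lmul_matrix transpose_matrix_vector)

text \<open>Scalarisation at a minimal point. The image of the orthant is finitely generated, so the
  cone to be separated from \<open>K\<close> is closed; this is what yields a multiplier that is
  strictly positive on \<open>K - {0}\<close>.\<close>

lemma cone_Min_multiplier:
  fixes K :: "(real ^ 'k) set" and C :: "real ^ 'n ^ 'k"
  assumes K: "convex_cone K" "closed K" "pointed K"
    and s: "s \<in> cone_Min ((\<lambda>x. C *v x) ` nonneg_orthant) K"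
  obtains l where "l \<in> strict_dual_cone K" "l \<bullet> s = 0" "transpose C *v l \<in> nonneg_orthant"
proof -
  obtain x0 where x0: "x0 \<in> nonneg_orthant" "s = C *v x0"
    using s by (auto simp: cone_Min_def)
  have minimal: "k = 0" if "x \<in> nonneg_orthant" "k \<in> K" "s - k = C *v x" for k x
  proof -
    have "\<not> cone_less K (C *v x) s"
      using s that(1) by (auto simp: cone_Min_def)
    then show ?thesis
      using that(2) by (auto simp: cone_less_def cone_le_def simp flip: that(3))
  qed
  \<comment> \<open>The generators are \<open>s\<close> and the negated columns of \<open>C\<close>.
    A bound on \<open>G\<close> alone will give every sign condition on \<open>l\<close>.\<close>
  define G where "G = insert s (range (\<lambda>i. - (C *v axis i 1)))"
  define Q where "Q = convex_cone hull G"
  \<comment> \<open>\<open>Q\<close> is visibly closed, being generated by a finite set, while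
    \<open>D\<close> gives its elements in coordinates. Only the inclusion of \<open>Q\<close> in
    \<open>D\<close> is needed.\<close>
  define D where "D = {t *\<^sub>R s - C *v x | t x. 0 \<le> t \<and> x \<in> nonneg_orthant}"
  have DI: "t *\<^sub>R s - C *v x \<in> D" if "0 \<le> t" "x \<in> nonneg_orthant" for t x
    using that by (auto simp: D_def)
  have "convex_cone D"
    unfolding convex_cone_iff
  proof (intro conjI ballI allI impI)
    show "0 \<in> D"
      using DI[of 0 0] by (simp add: nonneg_orthant_closed_under)
  next
    fix p q assume "p \<in> D" "q \<in> D"
    then obtain t x u y where *: "0 \<le> t" "x \<in> nonneg_orthant" "p = t *\<^sub>R s - C *v x"
      "0 \<le> u" "y \<in> nonneg_orthant" "q = u *\<^sub>R s - C *v y"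
      by (auto simp: D_def)
    have "p + q = (t + u) *\<^sub>R s - C *v (x + y)"
      using * by (simp add: algebra_simps matrix_vector_right_distrib)
    then show "p + q \<in> D"
      using DI[of "t + u" "x + y"] * by (simp add: nonneg_orthant_closed_under)
  next
    fix p :: "real ^ 'k" and c :: real assume "p \<in> D" "0 \<le> c"
    then obtain t x where *: "0 \<le> t" "x \<in> nonneg_orthant" "p = t *\<^sub>R s - C *v x"
      by (auto simp: D_def)
    have "c *\<^sub>R p = (c * t) *\<^sub>R s - C *v (c *\<^sub>R x)"
      by (simp add: *(3) scaleR_diff_right matrix_vector_mult_scaleR)
    then show "c *\<^sub>R p \<in> D"
      using DI[of "c * t" "c *\<^sub>R x"] * \<open>0 \<le> c\<close> by (simp add: nonneg_orthant_closed_under)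
  qed
  moreover have "G \<subseteq> D"
  proof -
    have "s \<in> D"
      using DI[of 1 0] by (simp add: nonneg_orthant_closed_under)
    moreover have "- (C *v axis i 1) \<in> D" for i
      using DI[of 0 "axis i 1"] by (simp add: nonneg_orthant_def axis_def)
    ultimately show ?thesis by (auto simp: G_def)
  qed
  ultimately have "Q \<subseteq> D"
    unfolding Q_def by (intro hull_minimal)
  have "K \<inter> Q \<subseteq> {0}"
  proof clarify
    fix k assume k: "k \<in> K" "k \<in> Q"
    then obtain t x where *: "0 \<le> t" "x \<in> nonneg_orthant" "k = t *\<^sub>R s - C *v x"
      using \<open>Q \<subseteq> D\<close> by (auto simp: D_def)
    \<comment> \<open>Adding \<open>s\<close> to both terms makes its coefficient positive, so that \<open>t = 0\<close> needs no
      separate treatment.\<close>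
    have "s - (1 / (1 + t)) *\<^sub>R k = C *v ((1 / (1 + t)) *\<^sub>R (x + x0))"
    proof -
      have "(1 + t) *\<^sub>R s - k = C *v (x + x0)"
        using * x0 by (simp add: algebra_simps matrix_vector_right_distrib)
      then have "(1 / (1 + t)) *\<^sub>R ((1 + t) *\<^sub>R s - k) = C *v ((1 / (1 + t)) *\<^sub>R (x + x0))"
        by (simp only: matrix_vector_mult_scaleR)
      then show ?thesis using *(1) by (simp add: scaleR_diff_right)
    qed
    moreover have "(1 / (1 + t)) *\<^sub>R k \<in> K"
      using K(1) k *(1) by (simp add: convex_cone_iff)
    moreover have "(1 / (1 + t)) *\<^sub>R (x + x0) \<in> nonneg_orthant"
      using * x0 by (simp add: nonneg_orthant_closed_under del: scaleR_add_right)
    ultimately have "(1 / (1 + t)) *\<^sub>R k = 0" using minimal by blast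
    then show "k = 0" using *(1) by simp
  qed
  moreover have "closed Q"
    unfolding Q_def G_def by (intro closed_convex_cone_hull) auto
  moreover have "convex_cone Q"
    by (simp add: Q_def convex_cone_convex_cone_hull)
  moreover have "x = 0" if "x \<in> K" "- x \<in> K" for x
  proof -
    have "x \<in> uminus ` K" using that(2) by force
    then show ?thesis using K(3) that(1) by (auto simp: pointed_def)
  qed
  ultimately obtain l where l: "\<And>x. x \<in> K - {0} \<Longrightarrow> 0 < l \<bullet> x" "\<And>x. x \<in> Q \<Longrightarrow> l \<bullet> x \<le> 0"
    using strict_separation_pointed_cone[OF K(1,2)] by metis
  have lG: "l \<bullet> g \<le> 0" if "g \<in> G" for g
    using l(2) that by (simp add: Q_def hull_inc)
  have dual: "0 \<le> (transpose C *v l) $ i" for i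
    using lG[of "- (C *v axis i 1)"] by (simp add: G_def transpose_mult_nth del: transpose_matrix_vector)
  \<comment> \<open>As a point of the image cone, \<open>s\<close> pairs nonnegatively with
    \<open>l\<close>; as a generator in \<open>G\<close> it pairs nonpositively. Hence the pairing
    is zero.\<close>
  have "l \<bullet> s = (transpose C *v l) \<bullet> x0"
    by (simp add: x0(2) dot_lmul_matrix)
  also have "0 \<le> \<dots>"
    using dual x0(1) by (auto simp: inner_vec_def nonneg_orthant_def intro!: sum_nonneg)
  finally have "l \<bullet> s = 0"
    using lG[of s] by (simp add: G_def)
  then show ?thesis
    using that[of l] l(1) dual by (auto simp: strict_dual_cone_def nonneg_orthant_def)
qed

theorem theorem8:
  fixes K :: "(real ^ 'k) set"
    and L :: "real ^ 'n ^ 'k"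
    and A :: "real ^ 'n ^ 'm"
    and b :: "real ^ 'm"
  assumes "cone K" and "nontrivial K" and "pointed K" and "closed K" and "convex K"
  shows "(\<Union>U \<in> dual_feasible_H K L A. dual_objective_H K L A b U)
           \<subseteq> dual_objective b ` dual_feasible K L A"
proof clarify
  fix U y assume "y \<in> dual_objective_H K L A b U"
  then obtain s where y: "y = U *v b + s"
    and s: "s \<in> cone_Min ((\<lambda>x. (L - U ** A) *v x) ` nonneg_orthant) K"
    by (auto simp: dual_objective_H_def)
  \<comment> \<open>\<open>convex_cone\<close> demands a nonempty set; \<open>pointed\<close>
    supplies this by forcing 0 into \<open>K\<close>.\<close>
  have "convex_cone K"
    using assms by (auto simp: convex_cone_def conic_def cone_def pointed_def)
  then obtain l where "l \<in> strict_dual_cone K" "l \<bullet> s = 0"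
    "transpose (L - U ** A) *v l \<in> nonneg_orthant"
    using cone_Min_multiplier s assms by metis
  then have "(l, U, s) \<in> dual_feasible K L A" by (simp add: dual_feasible_def)
  then show "y \<in> dual_objective b ` dual_feasible K L A"
    by (rule rev_image_eqI) (simp add: dual_objective_def y)
qed

end
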